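(* Let $\lambda$ be a nonzero real number. Define the degenerate A-algorithm matrix $(b_{n,m}(\lambda))_{n,m\ge0}$ by $b_{0,m}(\lambda)=\frac{\binom{m-\lambda}{m}}{m+1}$ for $m\ge0$ and \[ b_{n,m}(\lambda)=(m+1)\Big(\Big(1-\frac{(n-1)\lambda}{m+1}\Big)b_{n-1,m}(\lambda)-b_{n-1,m+1}(\lambda)\Big),\qquad n\ge1,\ m\ge0. \] Then for every $n\ge0$, \[ b_{n,0}(\lambda)=\sum_{k=0}^{n}(-1)^{k}k!\Big({n+1 \brace k+1}_{\lambda}+n\lambda {n \brace k+1}_{\lambda}\Big)\frac{\binom{k-\lambda}{k}}{k+1}=\beta_{n,\lambda}(1), \] and for every $n\ge1$, \[ \sum_{k=0}^{n}S_{1,\lambda}(n,k)\,\beta_{k,\lambda}(1)=(\lambda+1)(-1)^{n-1}\frac{(n-1-\lambda)_{n-1}}{n+1}. \]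
   Context: For $n\ge0$ set $(x)_{0,\lambda}=1$, $(x)_{n,\lambda}=x(x-\lambda)\cdots(x-(n-1)\lambda)$ for $n\ge1$, and $(x)_0=1$, $(x)_n=x(x-1)\cdots(x-n+1)$ for $n\ge1$; $\binom{k-\lambda}{k}=(k-\lambda)_k/k!$. The degenerate exponential is $e_\lambda^x(t)=\sum_{k\ge0}(x)_{k,\lambda}\frac{t^k}{k!}$ (i.e. $(1+\lambda t)^{x/\lambda}$), $e_\lambda(t)=e_\lambda^1(t)$, and $\log_\lambda$ is the compositional inverse of $e_\lambda$, so $\log_\lambda(1+t)=\sum_{n\ge1}\frac{(-1)^{n-1}}{n}\binom{n-1-\lambda}{n-1}t^n$. The degenerate Stirling numbers of the second kind ${n \brace k}_{\lambda}$ are defined by $(x)_{n,\lambda}=\sum_{k=0}^{n}{n \brace k}_{\lambda}(x)_{k}$ (zero for $k>n$); the degenerate Stirling numbers of the first kind $S_{1,\lambda}(n,k)$ are defined by $\frac{1}{k!}(\log_\lambda(1+t))^k=\sum_{n\ge k}S_{1,\lambda}(n,k)\frac{t^n}{n!}$. The degenerate Bernoulli polynomials are defined by $\frac{t}{e_\lambda(t)-1}e_\lambda^x(t)=\sum_{n\ge0}\beta_{n,\lambda}(x)\frac{t^n}{n!}$. *)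

theory Defs
  imports "HOL-Computational_Algebra.Computational_Algebra"
begin

text \<open>The degenerate falling factorial $(x)_{n,\lambda}$ and the ordinary one $(x)_n$.\<close>

definition deg_ffact :: "real \<Rightarrow> real \<Rightarrow> nat \<Rightarrow> real" where
  "deg_ffact lam x n = (\<Prod>i<n. x - real i * lam)"

definition ffact :: "real \<Rightarrow> nat \<Rightarrow> real" where
  "ffact x n = (\<Prod>i<n. x - real i)"

text \<open>The library binomial \<open>gchoose\<close> is the one used below: it is $(x)_k / k!$.\<close>

lemma gchoose_eq_ffact: "x gchoose k = ffact x k / fact k"
  by (simp add: gbinomial_prod_rev ffact_def atLeast0LessThan)

definition deg_exp :: "real \<Rightarrow> real \<Rightarrow> real fps" where
  "deg_exp lam x = Abs_fps (\<lambda>k. deg_ffact lam x k / fact k)"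

text \<open>
  The series $\log_\lambda(1+t)$. Since $\log_\lambda$ is the compositional inverse of
  $e_\lambda$, whose constant term is 1, this is the formal inverse of $e_\lambda(t) - 1$.
\<close>

definition deg_log_1p :: "real \<Rightarrow> real fps" where
  "deg_log_1p lam = fps_inv (deg_exp lam 1 - 1)"

lemma deg_exp_1_nth [simp]:
  "deg_exp lam 1 $ 0 = 1" "deg_exp lam 1 $ Suc 0 = 1"
  by (simp_all add: deg_exp_def deg_ffact_def)

lemma deg_exp_deg_log_1p: "deg_exp lam 1 oo deg_log_1p lam = 1 + fps_X"
proof -
  have "(deg_exp lam 1 - 1) oo deg_log_1p lam = fps_X"
    unfolding deg_log_1p_def by (rule fps_inv_right) simp_all
  then show ?thesis
    by (simp add: fps_compose_sub_distrib algebra_simps)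
qed

lemma deg_log_1p_deg_exp: "deg_log_1p lam oo (deg_exp lam 1 - 1) = fps_X"
  unfolding deg_log_1p_def by (rule fps_inv) simp_all

text \<open>
  Degenerate Stirling numbers of the second kind: row \<open>n\<close> is the coefficient sequence of
  $(x)_{n,\lambda}$ in the basis $(x)_k$, extended by 0 beyond $k = n$.
\<close>

definition deg_Stirling2_row :: "real \<Rightarrow> nat \<Rightarrow> (nat \<Rightarrow> real) \<Rightarrow> bool" where
  "deg_Stirling2_row lam n c \<longleftrightarrow>
     (\<forall>k>n. c k = 0) \<and> (\<forall>x. deg_ffact lam x n = (\<Sum>k\<le>n. c k * ffact x k))"

definition deg_Stirling2 :: "real \<Rightarrow> nat \<Rightarrow> nat \<Rightarrow> real" where
  "deg_Stirling2 lam n = (THE c. deg_Stirling2_row lam n c)"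

lemma deg_Stirling2_row_exists: "\<exists>c. deg_Stirling2_row lam n c"
proof (induction n)
  case 0
  have "deg_Stirling2_row lam 0 (\<lambda>k. if k = 0 then 1 else 0)"
    by (simp add: deg_Stirling2_row_def deg_ffact_def ffact_def)
  then show ?case
    by blast
next
  case (Suc n)
  then obtain c where c: "\<And>k. k > n \<Longrightarrow> c k = 0"
    and eq: "\<And>x. deg_ffact lam x n = (\<Sum>k\<le>n. c k * ffact x k)"
    by (auto simp: deg_Stirling2_row_def)
  define d where
    "d k = (if k = 0 then 0 else c (k - 1)) + (real k - real n * lam) * c k" for k
  have "deg_ffact lam x (Suc n) = (\<Sum>k\<le>Suc n. d k * ffact x k)" for x
  proof -
    have "deg_ffact lam x (Suc n) = (x - real n * lam) * (\<Sum>k\<le>n. c k * ffact x k)"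
      by (simp add: eq[symmetric] deg_ffact_def)
    also have "\<dots> = (\<Sum>k\<le>n. c k * ffact x (Suc k) + (real k - real n * lam) * c k * ffact x k)"
      unfolding sum_distrib_left by (rule sum.cong) (simp_all add: ffact_def algebra_simps)
    also have "\<dots> = (\<Sum>k\<le>n. c k * ffact x (Suc k))
        + (\<Sum>k\<le>Suc n. (real k - real n * lam) * c k * ffact x k)"
      by (simp add: sum.distrib c)
    also have "(\<Sum>k\<le>n. c k * ffact x (Suc k)) =
        (\<Sum>k\<le>Suc n. (if k = 0 then 0 else c (k - 1)) * ffact x k)"
      by (subst sum.atMost_Suc_shift) simp
    finally show ?thesis
      by (simp only: d_def sum.distrib[symmetric] distrib_right)
  qed
  moreover have "d k = 0" if "k > Suc n" for k
    using that by (simp add: d_def c)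
  ultimately show ?case
    unfolding deg_Stirling2_row_def by blast
qed

lemma deg_Stirling2_row_unique:
  assumes "deg_Stirling2_row lam n c" "deg_Stirling2_row lam n d"
  shows "c = d"
proof
  fix j show "c j = d j"
  proof (induction j rule: less_induct)
    case (less j)
    show ?case
    proof (cases "j \<le> n")
      case True
      have vanish: "ffact (real j) k = 0" if "k > j" for k
        unfolding ffact_def using that by (intro prod_zero) auto
      have nz: "ffact (real j) j \<noteq> 0"
        by (simp add: ffact_def)
      have split: "(\<Sum>k\<le>n. e k * ffact (real j) k)
          = (\<Sum>k<j. e k * ffact (real j) k) + e j * ffact (real j) j" for e :: "nat \<Rightarrow> real"
      proof -
        have "(\<Sum>k\<le>n. e k * ffact (real j) k) = (\<Sum>k\<le>j. e k * ffact (real j) k)"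
          using True by (intro sum.mono_neutral_right) (auto simp: vanish)
        then show ?thesis
          by (simp add: lessThan_Suc_atMost[symmetric])
      qed
      have "(\<Sum>k\<le>n. c k * ffact (real j) k) = (\<Sum>k\<le>n. d k * ffact (real j) k)"
        using assms by (simp add: deg_Stirling2_row_def)
      moreover have "(\<Sum>k<j. c k * ffact (real j) k) = (\<Sum>k<j. d k * ffact (real j) k)"
        by (rule sum.cong) (simp_all add: less)
      ultimately show ?thesis
        using nz by (simp add: split)
    next
      case False
      then show ?thesis
        using assms by (simp add: deg_Stirling2_row_def)
    qed
  qed
qed

lemma deg_Stirling2_row: "deg_Stirling2_row lam n (deg_Stirling2 lam n)"
proof -
  have "\<exists>!c. deg_Stirling2_row lam n c"
    using deg_Stirling2_row_exists deg_Stirling2_row_unique by (metis ex1I)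
  then show ?thesis
    unfolding deg_Stirling2_def by (rule theI')
qed

text \<open>Degenerate Stirling numbers of the first kind, by their generating function.\<close>

definition deg_Stirling1 :: "real \<Rightarrow> nat \<Rightarrow> nat \<Rightarrow> real" where
  "deg_Stirling1 lam n k = fact n * (fps_const (1 / fact k) * deg_log_1p lam ^ k) $ n"

lemma deg_Stirling1_eq_0: "n < k \<Longrightarrow> deg_Stirling1 lam n k = 0"
  by (simp add: deg_Stirling1_def deg_log_1p_def fps_inv_def startsby_zero_power_prefix)

text \<open>
  Values of the degenerate Bernoulli polynomials $\beta_{n,\lambda}(x)$. The series
  $e_\lambda(t) - 1$ has no constant term, so the quotient is the division of formal
  power series that cancels the common factor $t$.
\<close>

definition deg_Bernoulli :: "real \<Rightarrow> nat \<Rightarrow> real \<Rightarrow> real" where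
  "deg_Bernoulli lam n x = fact n * (fps_X / (deg_exp lam 1 - 1) * deg_exp lam x) $ n"

lemma deg_Bernoulli_quotient:
  "fps_X / (deg_exp lam 1 - 1) * (deg_exp lam 1 - 1) = fps_X"
proof -
  have "(deg_exp lam 1 - 1) $ Suc 0 \<noteq> 0"
    by simp
  then have ne: "deg_exp lam 1 - 1 \<noteq> 0"
    by (metis fps_zero_nth)
  have "subdegree (deg_exp lam 1 - 1) = 1"
    by (rule subdegreeI) simp_all
  then have "deg_exp lam 1 - 1 dvd fps_X"
    using ne by (simp add: fps_dvd_iff)
  then show ?thesis
    by simp
qed

text \<open>
  The matrix $b_{n,m}(\lambda)$; the recursion is stated for row $n+1$ in terms of row $n$.
\<close>

fun A_matrix :: "real \<Rightarrow> nat \<Rightarrow> nat \<Rightarrow> real" where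
  "A_matrix lam 0 m = ((real m - lam) gchoose m) / (real m + 1)"
| "A_matrix lam (Suc n) m =
     (real m + 1) * ((1 - real n * lam / (real m + 1)) * A_matrix lam n m - A_matrix lam n (m + 1))"

end

theory Submission
  imports Defs
begin

text \<open>
  Put $g = e_\lambda(t) - 1$, $L = \log_\lambda(1+t)$ and $P = (1+t) L / t$. Everything reduces to
  the identity $\sum_n \beta_{n,\lambda}(1) t^n / n! = P \circ g$: composing it with $L$ gives
  the second claim, and expanding it in powers of $g$, whose coefficients are the degenerate
  Stirling numbers of the second kind, gives the sum in the first one. As for the matrix, row
  $n + 1$ arises from row $n$ by the operator $D - n\lambda$, where
  $(D a)_m = (m+1)(a_m - a_{m+1})$. These operators commute, so they may be applied
  to the initial row in any order, and the coefficients of $b_{n,0}$ in terms of the initial row obey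
  the recursion of the Stirling numbers.
\<close>

section \<open>Recurrence of the second-kind numbers\<close>

lemma deg_Stirling2_eq_0: "n < k \<Longrightarrow> deg_Stirling2 lam n k = 0"
  using deg_Stirling2_row[of lam n] by (simp add: deg_Stirling2_row_def)

lemma deg_ffact_eq_sum_Stirling2:
  "deg_ffact lam x n = (\<Sum>k\<le>n. deg_Stirling2 lam n k * ffact x k)"
  using deg_Stirling2_row[of lam n] by (simp add: deg_Stirling2_row_def)

lemma deg_Stirling2_0: "deg_Stirling2 lam 0 k = (if k = 0 then 1 else 0)"
  using deg_ffact_eq_sum_Stirling2[of lam 0 0]
  by (simp add: deg_Stirling2_eq_0 deg_ffact_def ffact_def)

text \<open>In the expansion of \<open>deg_ffact lam x n\<close>, multiply the k-th term by x - n
  lam = (x - k) + (k - n lam); the part x - k raises \<open>ffact x k\<close> to the next basis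
  element. Uniqueness of the row finishes.\<close>

lemma deg_Stirling2_Suc:
  "deg_Stirling2 lam (Suc n) k =
     (if k = 0 then 0 else deg_Stirling2 lam n (k - 1))
       + (real k - real n * lam) * deg_Stirling2 lam n k"
proof -
  let ?c = "deg_Stirling2 lam n"
  define d where
    "d k = (if k = 0 then 0 else ?c (k - 1)) + (real k - real n * lam) * ?c k" for k
  have "deg_ffact lam x (Suc n) = (\<Sum>k\<le>Suc n. d k * ffact x k)" for x
  proof -
    have "deg_ffact lam x (Suc n) = (x - real n * lam) * (\<Sum>k\<le>n. ?c k * ffact x k)"
      by (simp add: deg_ffact_eq_sum_Stirling2[symmetric]) (simp add: deg_ffact_def)
    also have "\<dots> = (\<Sum>k\<le>n. ?c k * ffact x (Suc k) + (real k - real n * lam) * ?c k * ffact x k)"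
      unfolding sum_distrib_left by (rule sum.cong) (simp_all add: ffact_def algebra_simps)
    also have "\<dots> = (\<Sum>k\<le>n. ?c k * ffact x (Suc k))
        + (\<Sum>k\<le>Suc n. (real k - real n * lam) * ?c k * ffact x k)"
      by (simp add: sum.distrib deg_Stirling2_eq_0)
    also have "(\<Sum>k\<le>n. ?c k * ffact x (Suc k)) =
        (\<Sum>k\<le>Suc n. (if k = 0 then 0 else ?c (k - 1)) * ffact x k)"
      by (subst sum.atMost_Suc_shift) simp
    finally show ?thesis
      by (simp only: d_def sum.distrib[symmetric] distrib_right)
  qed
  moreover have "d k = 0" if "k > Suc n" for k
    using that by (simp add: d_def deg_Stirling2_eq_0)
  ultimately have "deg_Stirling2_row lam (Suc n) d"
    unfolding deg_Stirling2_row_def by blast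
  then have "deg_Stirling2 lam (Suc n) = d"
    by (rule deg_Stirling2_row_unique[OF deg_Stirling2_row])
  then show ?thesis
    by (simp add: d_def)
qed

section \<open>Powers of g generate the second-kind numbers\<close>

text \<open>The differential equation of (1 + lam t)^(x/lam).\<close>

lemma fps_deriv_deg_exp:
  "(1 + fps_const lam * fps_X) * fps_deriv (deg_exp lam x) = fps_const x * deg_exp lam x"
proof (rule fps_ext)
  fix n
  have "real (Suc n) * deg_exp lam x $ Suc n = (x - real n * lam) * deg_exp lam x $ n"
    by (simp add: deg_exp_def deg_ffact_def divide_simps mult_ac)
  then show "((1 + fps_const lam * fps_X) * fps_deriv (deg_exp lam x)) $ n
      = (fps_const x * deg_exp lam x) $ n"
    by (cases n) (simp_all add: distrib_right mult.assoc left_diff_distrib del: of_nat_Suc)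
qed

text \<open>Differentiate g^(k+1) and use (1 + lam t) g' = 1 + g. Up to factorials this is the
  recurrence \<open>deg_Stirling2_Suc\<close>.\<close>

lemma deg_exp_minus_1_power_nth_Suc:
  "real (Suc n) * (deg_exp lam 1 - 1) ^ Suc k $ Suc n =
     real (Suc k) * (deg_exp lam 1 - 1) ^ k $ n
       + (real (Suc k) - real n * lam) * (deg_exp lam 1 - 1) ^ Suc k $ n"
proof -
  define g where "g = deg_exp lam 1 - 1"
  have g': "(1 + fps_const lam * fps_X) * fps_deriv g = 1 + g"
    using fps_deriv_deg_exp[of lam 1] by (simp add: g_def)
  have "(1 + fps_const lam * fps_X) * fps_deriv (g ^ Suc k)
      = fps_const (real (Suc k)) * g ^ k * ((1 + fps_const lam * fps_X) * fps_deriv g)"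
    by (simp add: fps_deriv_power' fps_of_nat mult_ac del: of_nat_Suc power_Suc)
  also have "\<dots> = fps_const (real (Suc k)) * (g ^ k + g ^ Suc k)"
    unfolding g' by (simp add: algebra_simps)
  finally have "((1 + fps_const lam * fps_X) * fps_deriv (g ^ Suc k)) $ n
      = real (Suc k) * (g ^ k $ n + g ^ Suc k $ n)"
    by (simp del: of_nat_Suc power_Suc)
  moreover have "((1 + fps_const lam * fps_X) * fps_deriv (g ^ Suc k)) $ n
      = real (Suc n) * g ^ Suc k $ Suc n + lam * real n * g ^ Suc k $ n"
    by (cases n) (simp_all add: distrib_right mult.assoc del: of_nat_Suc power_Suc)
  ultimately show ?thesis
    unfolding g_def[symmetric] by (simp add: algebra_simps del: of_nat_Suc power_Suc)
qed

lemma deg_exp_minus_1_power_nth: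
  "(deg_exp lam 1 - 1) ^ k $ n = fact k / fact n * deg_Stirling2 lam n k"
proof (induction n arbitrary: k)
  case 0
  then show ?case
    by (simp add: deg_Stirling2_0 fps_nth_power_0 power_0_left)
next
  case (Suc n)
  show ?case
  proof (cases k)
    case 0
    \<comment> \<open>The power recurrence only covers positive exponents. In column 0 the
      hypothesis gives 0 for n > 0, and for n = 0 the weight n lam vanishes.\<close>
    have "deg_Stirling2 lam (Suc n) 0 = 0"
    proof (cases n)
      case (Suc m)
      then show ?thesis
        using Suc.IH[of 0] by (simp add: deg_Stirling2_Suc)
    qed (simp add: deg_Stirling2_Suc)
    then show ?thesis
      by (simp add: 0)
  next
    case (Suc j)
    have "(deg_exp lam 1 - 1) ^ Suc j $ Suc n =
        (real (Suc j) * (fact j / fact n * deg_Stirling2 lam n j)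
          + (real (Suc j) - real n * lam) * (fact (Suc j) / fact n * deg_Stirling2 lam n (Suc j)))
        / real (Suc n)"
      using deg_exp_minus_1_power_nth_Suc[of n lam j] unfolding Suc.IH
      by (simp add: field_simps del: of_nat_Suc power_Suc fact_Suc)
    also have "\<dots> = fact (Suc j) / fact (Suc n) * deg_Stirling2 lam (Suc n) (Suc j)"
    proof -
      \<comment> \<open>Here s f and t g stand for \<open>fact (Suc j)\<close> and
        \<open>fact (Suc n)\<close>.\<close>
      have "(s * (f / g * a) + c * (s * f / g * b)) / t = s * f / (t * g) * (a + c * b)"
        for s f g a b c t :: real
        by (simp add: add_divide_distrib distrib_left mult_ac)
      then show ?thesis
        by (simp add: deg_Stirling2_Suc del: of_nat_Suc)
    qed
    finally show ?thesis
      by (simp only: Suc)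
  qed
qed

lemma fps_compose_deg_exp_minus_1_nth:
  "fact n * (f oo (deg_exp lam 1 - 1)) $ n = (\<Sum>k\<le>n. f $ k * (fact k * deg_Stirling2 lam n k))"
  by (simp add: fps_compose_nth deg_exp_minus_1_power_nth sum_distrib_left atMost_atLeast0 field_simps)

section \<open>Coefficients of the degenerate logarithm\<close>

lemma deg_log_1p_nth_0 [simp]: "deg_log_1p lam $ 0 = 0"
  by (simp add: deg_log_1p_def fps_inv_def)

text \<open>Compose the differential equation of e with L, then cancel e' o L, whose product with L'
  is 1 by the chain rule.\<close>

lemma fps_deriv_deg_log_1p:
  "(1 + fps_X) * fps_deriv (deg_log_1p lam) = 1 + fps_const lam * deg_log_1p lam"
proof -
  let ?L = "deg_log_1p lam" and ?E = "deg_exp lam 1"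
  have "((1 + fps_const lam * fps_X) * fps_deriv ?E) oo ?L = ?E oo ?L"
    using fps_deriv_deg_exp[of lam 1] by simp
  then have 1: "(1 + fps_const lam * ?L) * (fps_deriv ?E oo ?L) = 1 + fps_X"
    by (simp add: fps_compose_mult_distrib fps_compose_add_distrib deg_exp_deg_log_1p)
  have 2: "(fps_deriv ?E oo ?L) * fps_deriv ?L = 1"
    using fps_compose_deriv[of ?L ?E] by (simp add: deg_exp_deg_log_1p)
  show ?thesis
    using 1 2 by (metis mult.assoc mult.right_neutral)
qed

lemma deg_log_1p_nth_rec:
  "real (Suc n) * deg_log_1p lam $ Suc n =
     (if n = 0 then 1 else 0) + (lam - real n) * deg_log_1p lam $ n"
  using arg_cong[OF fps_deriv_deg_log_1p[of lam], of "\<lambda>f. f $ n"]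
  by (cases n) (simp_all add: distrib_right algebra_simps)

lemma deg_log_1p_nth_Suc:
  "deg_log_1p lam $ Suc n = (-1) ^ n * ((real n - lam) gchoose n) / real (Suc n)"
proof -
  \<comment> \<open>Argument and length grow together, so the new factor is the first one.\<close>
  have ffact_rec: "ffact (real (Suc n) - lam) (Suc n) = (real (Suc n) - lam) * ffact (real n - lam) n" for n
    unfolding ffact_def by (subst prod.lessThan_Suc_shift) (simp add: algebra_simps)
  show ?thesis
  proof (induction n)
    case 0
    then show ?case
      using deg_log_1p_nth_rec[of 0 lam] by simp
  next
    case (Suc n)
    have "deg_log_1p lam $ Suc (Suc n)
        = (lam - real (Suc n)) * deg_log_1p lam $ Suc n / real (Suc (Suc n))"
      using deg_log_1p_nth_rec[of "Suc n" lam] by (simp add: field_simps del: of_nat_Suc)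
    then show ?case
      unfolding Suc.IH gchoose_eq_ffact ffact_rec by (simp add: field_simps)
  qed
qed

section \<open>The Bernoulli series as a composition\<close>

text \<open>
  The series $P$ of the introduction; \<open>fps_shift 1\<close> is the division by $t$ of a
  series without constant term.
\<close>

definition deg_Bernoulli_log :: "real \<Rightarrow> real fps" where
  "deg_Bernoulli_log lam = (1 + fps_X) * fps_shift 1 (deg_log_1p lam)"

lemma fps_shift_deg_log_1p: "fps_shift 1 (deg_log_1p lam) * fps_X = deg_log_1p lam"
  by (rule fps_ext) simp

text \<open>Composing L = (L/t) t with g gives t = ((L/t) o g) g, and cancelling g yields the
  quotient. At x = 1 the other factor is 1 + g, that is, (1 + t) o g.\<close>

lemma deg_Bernoulli_log_compose:
  "fps_X / (deg_exp lam 1 - 1) * deg_exp lam 1 = deg_Bernoulli_log lam oo (deg_exp lam 1 - 1)"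
proof -
  let ?g = "deg_exp lam 1 - 1"
  let ?K = "fps_shift 1 (deg_log_1p lam)"
  have ne: "?g \<noteq> 0"
    using deg_exp_1_nth(2)[of lam] by (auto simp: fps_eq_iff intro!: exI[of _ 1])
  have "(?K oo ?g) * ?g = (?K * fps_X) oo ?g"
    by (simp add: fps_compose_mult_distrib)
  also have "\<dots> = fps_X"
    by (simp add: fps_shift_deg_log_1p[unfolded One_nat_def] deg_log_1p_deg_exp)
  finally have "?K oo ?g = fps_X / ?g"
    using deg_Bernoulli_quotient[of lam] ne by (metis mult_right_cancel)
  then show ?thesis
    by (simp add: deg_Bernoulli_log_def fps_compose_mult_distrib fps_compose_add_distrib)
qed

lemma deg_Bernoulli_eq_compose:
  "deg_Bernoulli lam n 1 = fact n * (deg_Bernoulli_log lam oo (deg_exp lam 1 - 1)) $ n"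
  by (simp only: deg_Bernoulli_def deg_Bernoulli_log_compose)

lemma sum_deg_Stirling1_deg_Bernoulli:
  "(\<Sum>k\<le>n. deg_Stirling1 lam n k * deg_Bernoulli lam k 1) = fact n * deg_Bernoulli_log lam $ n"
proof -
  let ?g = "deg_exp lam 1 - 1" and ?L = "deg_log_1p lam"
  have "(\<Sum>k\<le>n. deg_Stirling1 lam n k * deg_Bernoulli lam k 1)
      = fact n * ((deg_Bernoulli_log lam oo ?g) oo ?L) $ n"
    by (simp add: fps_compose_nth[of _ ?L] deg_Bernoulli_eq_compose deg_Stirling1_def
        sum_distrib_left atMost_atLeast0 mult_ac)
  also have "(deg_Bernoulli_log lam oo ?g) oo ?L = deg_Bernoulli_log lam oo (?g oo ?L)"
    by (rule fps_compose_assoc[symmetric]) simp_all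
  also have "?g oo ?L = fps_X"
    by (simp add: fps_compose_sub_distrib deg_exp_deg_log_1p)
  finally show ?thesis
    by simp
qed

text \<open>For n >= 1 the coefficient of P is L_n + L_(n+1). Since (n+1) L_(n+1) = (lam - n) L_n,
  multiplying it by n + 1 leaves (lam + 1) L_n.\<close>

lemma deg_Bernoulli_log_nth:
  assumes "n \<ge> 1"
  shows "fact n * deg_Bernoulli_log lam $ n
    = (lam + 1) * (-1) ^ (n - 1) * (ffact (real n - 1 - lam) (n - 1) / (real n + 1))"
proof -
  obtain m where n: "n = Suc m"
    using assms by (cases n) auto
  have "real (Suc (Suc m)) * deg_Bernoulli_log lam $ n = (lam + 1) * deg_log_1p lam $ Suc m"
    using deg_log_1p_nth_rec[of "Suc m" lam]
    by (simp add: n deg_Bernoulli_log_def distrib_right algebra_simps)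
  moreover have "fact n * deg_log_1p lam $ Suc m = (-1) ^ m * ffact (real m - lam) m"
    by (simp add: n deg_log_1p_nth_Suc gchoose_eq_ffact del: of_nat_Suc)
  ultimately have "real (Suc (Suc m)) * (fact n * deg_Bernoulli_log lam $ n)
      = (lam + 1) * ((-1) ^ m * ffact (real m - lam) m)"
    by (metis mult.left_commute)
  then show ?thesis
    by (simp add: n field_simps)
qed

section \<open>The matrix rows as commuting operators\<close>

definition A_coeff :: "real \<Rightarrow> nat \<Rightarrow> nat \<Rightarrow> real" where
  "A_coeff lam n k = deg_Stirling2 lam (n + 1) (k + 1) + real n * lam * deg_Stirling2 lam n (k + 1)"

text \<open>The added term cancels the -n lam of the Stirling recurrence.\<close>

lemma A_coeff_eq:
  "A_coeff lam n k = deg_Stirling2 lam n k + (real k + 1) * deg_Stirling2 lam n (k + 1)"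
  by (simp add: A_coeff_def deg_Stirling2_Suc algebra_simps)

lemma A_coeff_eq_0: "n < k \<Longrightarrow> A_coeff lam n k = 0"
  by (simp add: A_coeff_eq deg_Stirling2_eq_0)

lemma A_coeff_Suc:
  "A_coeff lam (Suc n) k = (if k = 0 then 0 else A_coeff lam n (k - 1))
     + (real k + 1 - real n * lam) * A_coeff lam n k"
  by (cases k) (simp_all add: A_coeff_eq deg_Stirling2_Suc algebra_simps)

text \<open>The operator D - c for the D of the introduction.\<close>

definition A_step :: "real \<Rightarrow> (nat \<Rightarrow> real) \<Rightarrow> nat \<Rightarrow> real" where
  "A_step c a m = (real m + 1 - c) * a m - (real m + 1) * a (m + 1)"

text \<open>Both are the same operator D minus a scalar.\<close>

lemma A_step_commute: "A_step c (A_step d a) = A_step d (A_step c a)"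
  by (rule ext) (simp add: A_step_def algebra_simps)

text \<open>The initial row is a parameter because the induction below changes it.\<close>

fun A_rows :: "real \<Rightarrow> (nat \<Rightarrow> real) \<Rightarrow> nat \<Rightarrow> nat \<Rightarrow> real" where
  "A_rows lam a 0 = a"
| "A_rows lam a (Suc n) = A_step (real n * lam) (A_rows lam a n)"

lemma A_rows_A_step: "A_rows lam (A_step c a) n = A_step c (A_rows lam a n)"
  by (induction n) (simp_all add: A_step_commute[of c])

text \<open>The last operator is moved to the initial row, where the hypothesis applies to
  \<open>A_step ?d a\<close>; collecting the coefficient of each \<open>a k\<close> gives
  \<open>A_coeff_Suc\<close>.\<close>

lemma A_rows_0_eq_sum:
  "A_rows lam a n 0 = (\<Sum>k\<le>n. (-1) ^ k * fact k * A_coeff lam n k * a k)"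
proof (induction n arbitrary: a)
  case 0
  then show ?case
    by (simp add: A_coeff_eq deg_Stirling2_0)
next
  case (Suc n)
  let ?c = "A_coeff lam n" and ?d = "real n * lam"
  have "A_rows lam a (Suc n) 0 = A_rows lam (A_step ?d a) n 0"
    by (simp add: A_rows_A_step)
  also have "\<dots> = (\<Sum>k\<le>n. (-1) ^ k * fact k * ((real k + 1 - ?d) * ?c k) * a k)
      + (\<Sum>k\<le>n. (-1) ^ Suc k * fact (Suc k) * ?c k * a (Suc k))"
    unfolding Suc.IH sum.distrib[symmetric]
    by (rule sum.cong) (simp_all add: A_step_def algebra_simps)
  \<comment> \<open>The extra term vanishes since \<open>?c (Suc n)\<close> is 0.\<close>
  also have "(\<Sum>k\<le>n. (-1) ^ k * fact k * ((real k + 1 - ?d) * ?c k) * a k)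
      = (\<Sum>k\<le>Suc n. (-1) ^ k * fact k * ((real k + 1 - ?d) * ?c k) * a k)"
    by (simp add: A_coeff_eq_0)
  also have "(\<Sum>k\<le>n. (-1) ^ Suc k * fact (Suc k) * ?c k * a (Suc k))
      = (\<Sum>k\<le>Suc n. (-1) ^ k * fact k * (if k = 0 then 0 else ?c (k - 1)) * a k)"
    by (subst sum.atMost_Suc_shift) simp
  finally show ?case
    unfolding A_coeff_Suc sum.distrib[symmetric] by (simp only: algebra_simps)
qed

lemma A_matrix_eq_A_rows: "A_matrix lam n = A_rows lam (A_matrix lam 0) n"
proof (induction n)
  case (Suc n)
  have "A_matrix lam (Suc n) = A_step (real n * lam) (A_matrix lam n)"
    by (rule ext) (simp add: A_step_def field_simps)
  then show ?case
    by (simp only: Suc.IH A_rows.simps)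
qed simp

section \<open>The sum as a Bernoulli value\<close>

text \<open>By \<open>A_coeff_eq\<close> the sum splits in two; shifting the second by one index
  mirrors the factor 1 + t of P.\<close>

lemma sum_A_coeff_eq_deg_Bernoulli:
  "(\<Sum>k\<le>n. (-1) ^ k * fact k * A_coeff lam n k * A_matrix lam 0 k) = deg_Bernoulli lam n 1"
proof -
  let ?S = "deg_Stirling2 lam n"
  define l where "l k = deg_log_1p lam $ Suc k" for k
  \<comment> \<open>With alternating signs, the initial row lists the coefficients of L/t.\<close>
  have l: "(-1) ^ k * A_matrix lam 0 k = l k" for k
    by (simp add: l_def deg_log_1p_nth_Suc add_ac)
  have "(\<Sum>k\<le>n. (-1) ^ k * fact k * A_coeff lam n k * A_matrix lam 0 k)
      = (\<Sum>k\<le>n. l k * (fact k * ?S k)) + (\<Sum>k\<le>n. l k * (fact (Suc k) * ?S (Suc k)))"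
    unfolding sum.distrib[symmetric] l[symmetric]
    by (rule sum.cong) (simp_all add: A_coeff_eq algebra_simps)
  also have "(\<Sum>k\<le>n. l k * (fact (Suc k) * ?S (Suc k)))
      = (\<Sum>k\<le>Suc n. (if k = 0 then 0 else l (k - 1)) * (fact k * ?S k))"
    by (subst sum.atMost_Suc_shift) simp
  also have "\<dots> = (\<Sum>k\<le>n. (if k = 0 then 0 else l (k - 1)) * (fact k * ?S k))"
    by (simp add: deg_Stirling2_eq_0)
  also have "(\<Sum>k\<le>n. l k * (fact k * ?S k)) + \<dots>
      = (\<Sum>k\<le>n. deg_Bernoulli_log lam $ k * (fact k * ?S k))"
    unfolding sum.distrib[symmetric]
    by (rule sum.cong) (simp_all add: deg_Bernoulli_log_def l_def distrib_right)
  also have "\<dots> = deg_Bernoulli lam n 1"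
    by (simp only: fps_compose_deg_exp_minus_1_nth deg_Bernoulli_eq_compose)
  finally show ?thesis .
qed

theorem theorem3p3:
  fixes lam :: real
  assumes "lam \<noteq> 0"
  shows "(\<forall>n::nat.
            A_matrix lam n 0 =
              (\<Sum>k=0..n. (-1) ^ k * fact k
                 * (deg_Stirling2 lam (n + 1) (k + 1) + real n * lam * deg_Stirling2 lam n (k + 1))
                 * (((real k - lam) gchoose k) / (real k + 1)))
          \<and> (\<Sum>k=0..n. (-1) ^ k * fact k
                 * (deg_Stirling2 lam (n + 1) (k + 1) + real n * lam * deg_Stirling2 lam n (k + 1))
                 * (((real k - lam) gchoose k) / (real k + 1)))
              = deg_Bernoulli lam n 1)
       \<and> (\<forall>n::nat. n \<ge> 1 \<longrightarrow>
            (\<Sum>k=0..n. deg_Stirling1 lam n k * deg_Bernoulli lam k 1)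
              = (lam + 1) * (-1) ^ (n - 1) * (ffact (real n - 1 - lam) (n - 1) / (real n + 1)))"
proof (intro conjI allI impI)
  fix n
  have eq: "(\<Sum>k=0..n. (-1) ^ k * fact k
                 * (deg_Stirling2 lam (n + 1) (k + 1) + real n * lam * deg_Stirling2 lam n (k + 1))
                 * (((real k - lam) gchoose k) / (real k + 1)))
      = (\<Sum>k\<le>n. (-1) ^ k * fact k * A_coeff lam n k * A_matrix lam 0 k)"
    by (simp only: A_coeff_def A_matrix.simps atMost_atLeast0)
  show "A_matrix lam n 0 = (\<Sum>k=0..n. (-1) ^ k * fact k
                 * (deg_Stirling2 lam (n + 1) (k + 1) + real n * lam * deg_Stirling2 lam n (k + 1))
                 * (((real k - lam) gchoose k) / (real k + 1)))"
    unfolding eq by (subst A_matrix_eq_A_rows) (rule A_rows_0_eq_sum)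
  show "(\<Sum>k=0..n. (-1) ^ k * fact k
                 * (deg_Stirling2 lam (n + 1) (k + 1) + real n * lam * deg_Stirling2 lam n (k + 1))
                 * (((real k - lam) gchoose k) / (real k + 1))) = deg_Bernoulli lam n 1"
    unfolding eq by (rule sum_A_coeff_eq_deg_Bernoulli)
next
  fix n :: nat
  assume "n \<ge> 1"
  then show "(\<Sum>k=0..n. deg_Stirling1 lam n k * deg_Bernoulli lam k 1)
      = (lam + 1) * (-1) ^ (n - 1) * (ffact (real n - 1 - lam) (n - 1) / (real n + 1))"
    using sum_deg_Stirling1_deg_Bernoulli[where lam = lam and n = n]
      deg_Bernoulli_log_nth[of n lam] by (simp only: atMost_atLeast0)
qed

end
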